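(* Let $\mathcal{C}$ be an equational class of algebras. If $\mathcal{C}$ is semi-degenerate and has equationally definable principal congruences (EDPC), then every admissible morphism in $\mathcal{C}$ fulfills LO.
   Context: An equational class (variety) $\mathcal{C}$ of algebras of a fixed type is semi-degenerate if no non-trivial algebra in $\mathcal{C}$ has a one-element subalgebra. All algebras are non-empty; a morphism in $\mathcal{C}$ is a homomorphism between members of $\mathcal{C}$. For an algebra $M$, $\mathrm{Con}(M)$ is its congruence lattice, $\Delta_M$ is the equality relation, $\nabla_M=M^2$, and $Cg_M(a,b)$ is the congruence of $M$ generated by $(a,b)$. $\mathcal{C}$ has EDPC if there exist an integer $n\geq1$ and $4$-ary terms $p_1,q_1,\ldots,p_n,q_n$ in the language of $\mathcal{C}$ such that, for every algebra $M$ in $\mathcal{C}$ and all $a,b\in M$, $Cg_M(a,b)=\{(c,d)\in M^2 : p_i^M(a,b,c,d)=q_i^M(a,b,c,d)\text{ for all } i\in\{1,\ldots,n\}\}$. A class with EDPC is congruence-distributive (all its members have distributive congruence lattices), and hence the (modular) commutator of congruences in its members is the intersection; so a congruence $\phi\neq\nabla_M$ is prime if, for all $\alpha,\beta\in\mathrm{Con}(M)$, $\alpha\cap\beta\subseteq\phi$ implies $\alpha\subseteq\phi$ or $\beta\subseteq\phi$; $\mathrm{Spec}(M)$ is the set of prime congruences of $M$. For a morphism $f:A\to B$ and $\psi\in\mathrm{Con}(B)$, $f^*(\psi)=\{(x,y)\in A^2 : (f(x),f(y))\in\psi\}\in\mathrm{Con}(A)$ and $\mathrm{Ker}(f)=f^*(\Delta_B)$.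 $f$ is admissible if $f^*(\psi)\in\mathrm{Spec}(A)$ for all $\psi\in\mathrm{Spec}(B)$. An admissible morphism $f:A\to B$ fulfills LO (Lying Over) if for every $\phi\in\mathrm{Spec}(A)$ with $\mathrm{Ker}(f)\subseteq\phi$ there is $\phi_1\in\mathrm{Spec}(B)$ with $f^*(\phi_1)=\phi$. *)

theory Defs
  imports Main
begin

section \<open>Algebras of a fixed type\<close>

text \<open>
  The operation symbols form a set rather than a whole type, so that the empty type of algebras
  is covered.
\<close>

record 'f signature =
  symbols :: "'f set"
  arity :: "'f \<Rightarrow> nat"

record ('f, 'a) algebra =
  carrier :: "'a set"
  interp :: "'f \<Rightarrow> 'a list \<Rightarrow> 'a"

text \<open>
  The values of \<open>interp\<close> outside the signature, or on arguments that are not lists of the right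
  length over the carrier, are irrelevant: they are ignored everywhere below.
\<close>

definition is_algebra :: "'f signature \<Rightarrow> ('f, 'a) algebra \<Rightarrow> bool" where
  "is_algebra L M \<longleftrightarrow>
     carrier M \<noteq> {} \<and>
     (\<forall>\<sigma>\<in>symbols L. \<forall>xs. set xs \<subseteq> carrier M \<and> length xs = arity L \<sigma> \<longrightarrow>
        interp M \<sigma> xs \<in> carrier M)"

definition subalgebra :: "'f signature \<Rightarrow> 'a set \<Rightarrow> ('f, 'a) algebra \<Rightarrow> bool" where
  "subalgebra L S M \<longleftrightarrow> S \<subseteq> carrier M \<and> is_algebra L (M\<lparr>carrier := S\<rparr>)"

definition trivial_algebra :: "('f, 'a) algebra \<Rightarrow> bool" where
  "trivial_algebra M \<longleftrightarrow> (\<exists>x. carrier M = {x})"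

definition hom :: "'f signature \<Rightarrow> ('f, 'a) algebra \<Rightarrow> ('f, 'b) algebra \<Rightarrow> ('a \<Rightarrow> 'b) set" where
  "hom L A B = {f. f ` carrier A \<subseteq> carrier B \<and>
     (\<forall>\<sigma>\<in>symbols L. \<forall>xs. set xs \<subseteq> carrier A \<and> length xs = arity L \<sigma> \<longrightarrow>
        f (interp A \<sigma> xs) = interp B \<sigma> (map f xs))}"


section \<open>Terms and equational classes\<close>

datatype 'f trm = Var nat | Op 'f "'f trm list"

text \<open>Terms of the language \<open>L\<close> with variables among \<open>Var i\<close>, \<open>i \<in> X\<close>.\<close>

inductive_set terms :: "'f signature \<Rightarrow> nat set \<Rightarrow> 'f trm set"
  for L :: "'f signature" and X :: "nat set" where
  Var: "i \<in> X \<Longrightarrow> Var i \<in> terms L X"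
| Op: "\<sigma> \<in> symbols L \<Longrightarrow> length ts = arity L \<sigma> \<Longrightarrow> (\<And>t. t \<in> set ts \<Longrightarrow> t \<in> terms L X) \<Longrightarrow>
        Op \<sigma> ts \<in> terms L X"

primrec term_val :: "('f, 'a) algebra \<Rightarrow> (nat \<Rightarrow> 'a) \<Rightarrow> 'f trm \<Rightarrow> 'a" where
  "term_val M v (Var i) = v i"
| "term_val M v (Op \<sigma> ts) = interp M \<sigma> (map (term_val M v) ts)"

definition satisfies :: "('f, 'a) algebra \<Rightarrow> 'f trm \<times> 'f trm \<Rightarrow> bool" where
  "satisfies M e \<longleftrightarrow>
     (\<forall>v. range v \<subseteq> carrier M \<longrightarrow> term_val M v (fst e) = term_val M v (snd e))"

text \<open>
  HOL cannot quantify over types inside a formula, so a class of algebras is a set of algebras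
  whose carriers are subsets of one type \<open>'a\<close>, which plays the role of the universe of sets.
  The type is arbitrary: any two given algebras, on types \<open>'b\<close> and \<open>'c\<close>, have isomorphic copies
  on subsets of \<open>'b + 'c\<close>, and a property required of all algebras in an equational class
  holds in particular for those carried by subsets of \<open>'a\<close>.
\<close>

definition equational_class :: "'f signature \<Rightarrow> ('f, 'a) algebra set \<Rightarrow> bool" where
  "equational_class L \<C> \<longleftrightarrow>
     (\<exists>E \<subseteq> terms L UNIV \<times> terms L UNIV. \<C> = {M. is_algebra L M \<and> (\<forall>e\<in>E. satisfies M e)})"

definition semi_degenerate :: "'f signature \<Rightarrow> ('f, 'a) algebra set \<Rightarrow> bool" where
  "semi_degenerate L \<C> \<longleftrightarrow>
     (\<forall>M\<in>\<C>. \<not> trivial_algebra M \<longrightarrow> \<not> (\<exists>e. subalgebra L {e} M))"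


section \<open>Congruences\<close>

definition Con :: "'f signature \<Rightarrow> ('f, 'a) algebra \<Rightarrow> 'a rel set" where
  "Con L M = {\<theta>. equiv (carrier M) \<theta> \<and>
     (\<forall>\<sigma>\<in>symbols L. \<forall>xs ys. length xs = arity L \<sigma> \<and> list_all2 (\<lambda>x y. (x, y) \<in> \<theta>) xs ys \<longrightarrow>
        (interp M \<sigma> xs, interp M \<sigma> ys) \<in> \<theta>)}"

abbreviation Delta :: "('f, 'a) algebra \<Rightarrow> 'a rel" where
  "Delta M \<equiv> Id_on (carrier M)"

abbreviation Nabla :: "('f, 'a) algebra \<Rightarrow> 'a rel" where
  "Nabla M \<equiv> carrier M \<times> carrier M"

definition Cg :: "'f signature \<Rightarrow> ('f, 'a) algebra \<Rightarrow> 'a \<Rightarrow> 'a \<Rightarrow> 'a rel" where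
  "Cg L M a b = \<Inter> {\<theta> \<in> Con L M. (a, b) \<in> \<theta>}"

text \<open>
  A \<open>4\<close>-ary term is a term in the variables \<open>Var 0, \<dots>, Var 3\<close>; its value at \<open>(a, b, c, d)\<close> uses
  the valuation \<open>(!) [a, b, c, d]\<close>, whose values at other indices play no role.
\<close>

definition has_EDPC :: "'f signature \<Rightarrow> ('f, 'a) algebra set \<Rightarrow> bool" where
  "has_EDPC L \<C> \<longleftrightarrow>
     (\<exists>n\<ge>1. \<exists>p q :: nat \<Rightarrow> 'f trm.
        (\<forall>i\<in>{1..n}. p i \<in> terms L {..<4} \<and> q i \<in> terms L {..<4}) \<and>
        (\<forall>M\<in>\<C>. \<forall>a\<in>carrier M. \<forall>b\<in>carrier M.
           Cg L M a b =
             {(c, d) \<in> carrier M \<times> carrier M.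
                \<forall>i\<in>{1..n}. term_val M ((!) [a, b, c, d]) (p i) =
                            term_val M ((!) [a, b, c, d]) (q i)}))"

text \<open>
  Primeness is formulated with the intersection, which is the commutator of congruences in the
  congruence-distributive setting, such as that of a class with EDPC.
\<close>

definition Spec :: "'f signature \<Rightarrow> ('f, 'a) algebra \<Rightarrow> 'a rel set" where
  "Spec L M = {\<phi> \<in> Con L M. \<phi> \<noteq> Nabla M \<and>
     (\<forall>\<alpha>\<in>Con L M. \<forall>\<beta>\<in>Con L M. \<alpha> \<inter> \<beta> \<subseteq> \<phi> \<longrightarrow> \<alpha> \<subseteq> \<phi> \<or> \<beta> \<subseteq> \<phi>)}"


section \<open>Admissible morphisms and Lying Over\<close>

definition pullback :: "('f, 'a) algebra \<Rightarrow> ('a \<Rightarrow> 'b) \<Rightarrow> 'b rel \<Rightarrow> 'a rel" where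
  "pullback A f \<psi> = {(x, y) \<in> carrier A \<times> carrier A. (f x, f y) \<in> \<psi>}"

definition Ker :: "('f, 'a) algebra \<Rightarrow> ('f, 'b) algebra \<Rightarrow> ('a \<Rightarrow> 'b) \<Rightarrow> 'a rel" where
  "Ker A B f = pullback A f (Delta B)"

definition admissible ::
    "'f signature \<Rightarrow> ('f, 'a) algebra \<Rightarrow> ('f, 'b) algebra \<Rightarrow> ('a \<Rightarrow> 'b) \<Rightarrow> bool" where
  "admissible L A B f \<longleftrightarrow> (\<forall>\<psi>\<in>Spec L B. pullback A f \<psi> \<in> Spec L A)"

definition fulfills_LO ::
    "'f signature \<Rightarrow> ('f, 'a) algebra \<Rightarrow> ('f, 'b) algebra \<Rightarrow> ('a \<Rightarrow> 'b) \<Rightarrow> bool" where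
  "fulfills_LO L A B f \<longleftrightarrow>
     (\<forall>\<phi>\<in>Spec L A. Ker A B f \<subseteq> \<phi> \<longrightarrow> (\<exists>\<phi>\<^sub>1\<in>Spec L B. pullback A f \<phi>\<^sub>1 = \<phi>))"

end

theory Submission
  imports Defs
begin

text \<open>
  Passing to \<open>M/\<delta>\<close>, EDPC says that \<open>\<delta> \<or> Cg(s,t)\<close> consists of all \<open>(c,d)\<close> such that \<open>\<delta>\<close>
  identifies \<open>p\<^sub>i(s,t,c,d)\<close> with \<open>q\<^sub>i(s,t,c,d)\<close> for all \<open>i\<close>. This description commutes visibly
  with pullbacks along homomorphisms and with intersections in \<open>\<delta>\<close>. Given a prime \<open>\<phi>\<close> above
  \<open>Ker f\<close>, choose \<open>\<theta>\<close> maximal among the congruences of \<open>B\<close> with \<open>f\<^sup>*(\<theta>) \<subseteq> \<phi>\<close>. For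
  \<open>(a,b) \<in> \<phi>\<close> the congruence \<open>f\<^sup>*(\<theta> \<or> Cg(f a, f b)) = f\<^sup>*(\<theta>) \<or> Cg(a,b)\<close> is still below
  \<open>\<phi>\<close>, so maximality gives \<open>f\<^sup>*(\<theta>) = \<phi>\<close>. If \<open>\<alpha> \<inter> \<beta> \<subseteq> \<theta>\<close>, enlarge first \<open>\<alpha>\<close> and then \<open>\<beta>\<close> as
  far as this inclusion permits; because joins with principal congruences distribute over
  intersections, the enlarged congruences contain \<open>\<theta>\<close>, and primeness of \<open>\<phi>\<close> together with the
  maximality of \<open>\<theta>\<close> forces one of them to be \<open>\<theta>\<close>.
\<close>

section \<open>Congruences and their intersections\<close>

lemma ConI:
  assumes "\<theta> \<subseteq> Nabla M"
    and "\<And>x. x \<in> carrier M \<Longrightarrow> (x, x) \<in> \<theta>"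
    and "\<And>x y. (x, y) \<in> \<theta> \<Longrightarrow> (y, x) \<in> \<theta>"
    and "\<And>x y z. (x, y) \<in> \<theta> \<Longrightarrow> (y, z) \<in> \<theta> \<Longrightarrow> (x, z) \<in> \<theta>"
    and "\<And>\<sigma> xs ys. \<sigma> \<in> symbols L \<Longrightarrow> length xs = arity L \<sigma> \<Longrightarrow>
      list_all2 (\<lambda>x y. (x, y) \<in> \<theta>) xs ys \<Longrightarrow> (interp M \<sigma> xs, interp M \<sigma> ys) \<in> \<theta>"
  shows "\<theta> \<in> Con L M"
proof -
  have "equiv (carrier M) \<theta>"
    using assms(1,2) symI[of \<theta>, OF assms(3)] transI[of \<theta>, OF assms(4)]
    by (simp add: equivI refl_onI)
  with assms(5) show ?thesis
    unfolding Con_def by blast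
qed

lemma
  assumes "\<theta> \<in> Con L M"
  shows Con_subset: "\<theta> \<subseteq> Nabla M"
    and Con_refl: "x \<in> carrier M \<Longrightarrow> (x, x) \<in> \<theta>"
    and Con_sym: "(x, y) \<in> \<theta> \<Longrightarrow> (y, x) \<in> \<theta>"
    and Con_trans: "(x, y) \<in> \<theta> \<Longrightarrow> (y, z) \<in> \<theta> \<Longrightarrow> (x, z) \<in> \<theta>"
    and Con_interp: "\<sigma> \<in> symbols L \<Longrightarrow> length xs = arity L \<sigma> \<Longrightarrow>
      list_all2 (\<lambda>x y. (x, y) \<in> \<theta>) xs ys \<Longrightarrow> (interp M \<sigma> xs, interp M \<sigma> ys) \<in> \<theta>"
proof -
  have eq: "equiv (carrier M) \<theta>"
    using assms by (simp add: Con_def)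
  show "\<theta> \<subseteq> Nabla M"
    using eq by (rule equiv_type)
  show "x \<in> carrier M \<Longrightarrow> (x, x) \<in> \<theta>"
    using eq by (auto elim!: equivE dest: refl_onD)
  show "(x, y) \<in> \<theta> \<Longrightarrow> (y, x) \<in> \<theta>"
    using eq by (auto elim!: equivE dest: symD)
  show "(x, y) \<in> \<theta> \<Longrightarrow> (y, z) \<in> \<theta> \<Longrightarrow> (x, z) \<in> \<theta>"
    using eq by (auto elim!: equivE dest: transD)
  show "\<sigma> \<in> symbols L \<Longrightarrow> length xs = arity L \<sigma> \<Longrightarrow>
      list_all2 (\<lambda>x y. (x, y) \<in> \<theta>) xs ys \<Longrightarrow> (interp M \<sigma> xs, interp M \<sigma> ys) \<in> \<theta>"
    using assms by (simp add: Con_def)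
qed

lemma interp_closed:
  assumes "is_algebra L M" "\<sigma> \<in> symbols L" "set xs \<subseteq> carrier M" "length xs = arity L \<sigma>"
  shows "interp M \<sigma> xs \<in> carrier M"
  using assms by (simp add: is_algebra_def)

lemma list_all2_subset_Nabla:
  assumes "list_all2 (\<lambda>x y. (x, y) \<in> \<theta>) xs ys" "\<theta> \<subseteq> A \<times> A"
  shows "set xs \<subseteq> A" "set ys \<subseteq> A"
  using assms by (induction rule: list_all2_induct) auto

lemma Nabla_in_Con:
  assumes "is_algebra L M"
  shows "Nabla M \<in> Con L M"
proof (rule ConI)
  fix \<sigma> xs ys
  assume \<sigma>: "\<sigma> \<in> symbols L" and len: "length xs = arity L \<sigma>"
    and rel: "list_all2 (\<lambda>x y. (x, y) \<in> Nabla M) xs ys"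
  from list_all2_subset_Nabla[OF rel order_refl] list_all2_lengthD[OF rel] \<sigma> len
  show "(interp M \<sigma> xs, interp M \<sigma> ys) \<in> Nabla M"
    using interp_closed[OF assms] by auto
qed auto

lemma Delta_in_Con:
  assumes "is_algebra L M"
  shows "Delta M \<in> Con L M"
proof (rule ConI)
  fix \<sigma> xs ys
  assume \<sigma>: "\<sigma> \<in> symbols L" and len: "length xs = arity L \<sigma>"
    and rel: "list_all2 (\<lambda>x y. (x, y) \<in> Delta M) xs ys"
  have "xs = ys"
    using rel by (induction rule: list_all2_induct) auto
  moreover have "set xs \<subseteq> carrier M"
    using list_all2_subset_Nabla(1)[OF rel] by blast
  ultimately show "(interp M \<sigma> xs, interp M \<sigma> ys) \<in> Delta M"
    using interp_closed[OF assms \<sigma>] len by auto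
qed auto

lemma Inter_in_Con:
  assumes "S \<noteq> {}" "S \<subseteq> Con L M"
  shows "\<Inter>S \<in> Con L M"
proof (rule ConI)
  show "\<Inter>S \<subseteq> Nabla M"
    using assms Con_subset by blast
  show "(x, x) \<in> \<Inter>S" if "x \<in> carrier M" for x
    using assms that by (blast intro: Con_refl)
  show "(y, x) \<in> \<Inter>S" if "(x, y) \<in> \<Inter>S" for x y
    using assms that by (blast intro: Con_sym)
  show "(x, z) \<in> \<Inter>S" if "(x, y) \<in> \<Inter>S" "(y, z) \<in> \<Inter>S" for x y z
    using assms that by (blast intro: Con_trans)
  show "(interp M \<sigma> xs, interp M \<sigma> ys) \<in> \<Inter>S"
    if "\<sigma> \<in> symbols L" "length xs = arity L \<sigma>" "list_all2 (\<lambda>x y. (x, y) \<in> \<Inter>S) xs ys"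
    for \<sigma> xs ys
  proof
    fix \<theta> assume "\<theta> \<in> S"
    then show "(interp M \<sigma> xs, interp M \<sigma> ys) \<in> \<theta>"
      using assms(2) that by (intro Con_interp[of \<theta> L]) (auto elim: list_all2_mono)
  qed
qed

lemma Cg_in_Con:
  assumes "is_algebra L M" "a \<in> carrier M" "b \<in> carrier M"
  shows "Cg L M a b \<in> Con L M"
  \<comment> \<open>\<open>Nabla M\<close> witnesses that the family is nonempty; an empty
    intersection would be \<open>UNIV\<close>.\<close>
  unfolding Cg_def using Nabla_in_Con[OF assms(1)] assms(2,3) by (intro Inter_in_Con) auto

section \<open>Unions of chains and maximal congruences\<close>

text \<open>Operations have finite arity, so only finitely many pairs of the union matter at a time;
  of two members of the chain the larger one serves both.\<close>

lemma chain_list_all2: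
  assumes "subset.chain \<A> S" "S \<noteq> {}" "list_all2 (\<lambda>x y. (x, y) \<in> \<Union>S) xs ys"
  shows "\<exists>\<theta>\<in>S. list_all2 (\<lambda>x y. (x, y) \<in> \<theta>) xs ys"
  using assms(3)
proof (induction rule: list_all2_induct)
  case Nil
  then show ?case using assms(2) by auto
next
  case (Cons x xs y ys)
  then obtain \<theta> \<theta>' where \<theta>: "\<theta> \<in> S" "(x, y) \<in> \<theta>"
    and \<theta>': "\<theta>' \<in> S" "list_all2 (\<lambda>x y. (x, y) \<in> \<theta>') xs ys"
    by auto
  from \<theta>(1) \<theta>'(1) assms(1) consider "\<theta> \<subseteq> \<theta>'" | "\<theta>' \<subseteq> \<theta>"
    unfolding subset.chain_def by blast
  then show ?case
  proof cases
    case 1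
    with \<theta> \<theta>' show ?thesis by auto
  next
    case 2
    then have "list_all2 (\<lambda>x y. (x, y) \<in> \<theta>) xs ys"
      using \<theta>'(2) by (auto elim: list_all2_mono)
    with \<theta> show ?thesis by auto
  qed
qed

lemma chain_Union_in_Con:
  assumes chain: "subset.chain (Con L M) S" and ne: "S \<noteq> {}"
  shows "\<Union>S \<in> Con L M"
proof (rule ConI)
  have S: "S \<subseteq> Con L M"
    using chain by (simp add: subset.chain_def)
  show "\<Union>S \<subseteq> Nabla M"
    using S Con_subset by blast
  show "(x, x) \<in> \<Union>S" if "x \<in> carrier M" for x
    using S ne that by (blast intro: Con_refl)
  show "(y, x) \<in> \<Union>S" if "(x, y) \<in> \<Union>S" for x y
    using S that by (blast intro: Con_sym)
  show "(x, z) \<in> \<Union>S" if "(x, y) \<in> \<Union>S" "(y, z) \<in> \<Union>S" for x y z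
  proof -
    \<comment> \<open>Listing the two pairs as one instance of \<open>chain_list_all2\<close> puts
      them into a common member of the chain.\<close>
    have "list_all2 (\<lambda>x y. (x, y) \<in> \<Union>S) [x, y] [y, z]"
      using that by simp
    from chain_list_all2[OF chain ne this] S show ?thesis
      by (auto intro: Con_trans)
  qed
  show "(interp M \<sigma> xs, interp M \<sigma> ys) \<in> \<Union>S"
    if "\<sigma> \<in> symbols L" "length xs = arity L \<sigma>" "list_all2 (\<lambda>x y. (x, y) \<in> \<Union>S) xs ys"
    for \<sigma> xs ys
    using chain_list_all2[OF chain ne that(3)] S that(1,2) by (blast intro: Con_interp)
qed

text \<open>Zorn's lemma: disjointness from a fixed set of pairs survives unions of chains. The
  later maximality conditions are therefore phrased as avoiding a suitable \<open>N\<close>.\<close>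

lemma maximal_congruence_avoiding:
  assumes "\<alpha> \<in> Con L M" "\<alpha> \<inter> N = {}"
  obtains \<delta> where "\<delta> \<in> Con L M" "\<alpha> \<subseteq> \<delta>" "\<delta> \<inter> N = {}"
    "\<And>\<epsilon>. \<epsilon> \<in> Con L M \<Longrightarrow> \<delta> \<subseteq> \<epsilon> \<Longrightarrow> \<epsilon> \<inter> N = {} \<Longrightarrow> \<epsilon> = \<delta>"
proof -
  let ?\<A> = "{\<delta> \<in> Con L M. \<alpha> \<subseteq> \<delta> \<and> \<delta> \<inter> N = {}}"
  have "\<exists>\<delta>\<in>?\<A>. \<forall>\<epsilon>\<in>?\<A>. \<delta> \<subseteq> \<epsilon> \<longrightarrow> \<epsilon> = \<delta>"
  proof (rule subset_Zorn_nonempty)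
    show "?\<A> \<noteq> {}"
      using assms by auto
    fix S assume ne: "S \<noteq> {}" and chain: "subset.chain ?\<A> S"
    then have S: "S \<subseteq> ?\<A>"
      by (simp add: subset.chain_def)
    have "subset.chain (Con L M) S"
      using chain by (auto simp: subset.chain_def)
    then have "\<Union>S \<in> Con L M"
      using ne by (rule chain_Union_in_Con)
    moreover have "\<alpha> \<subseteq> \<Union>S" "\<Union>S \<inter> N = {}"
      using ne S by blast+
    ultimately show "\<Union>S \<in> ?\<A>"
      by simp
  qed
  then show thesis
    using that by (smt (verit) mem_Collect_eq order_trans)
qed

section \<open>Terms and pullbacks along homomorphisms\<close>

text \<open>The valuations are constrained only on \<open>X\<close>, because
  \<open>(!) [a, b, c, d]\<close> is unspecified beyond index 3.\<close>

lemma term_val_hom: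
  assumes "is_algebra L A" "h \<in> hom L A B" "t \<in> terms L X"
    and "\<And>i. i \<in> X \<Longrightarrow> v i \<in> carrier A" "\<And>i. i \<in> X \<Longrightarrow> w i = h (v i)"
  shows "term_val A v t \<in> carrier A \<and> term_val B w t = h (term_val A v t)"
  using assms(3)
proof (induction rule: terms.induct)
  case (Var i)
  then show ?case using assms(4,5) by simp
next
  case (Op \<sigma> ts)
  have closed: "set (map (term_val A v) ts) \<subseteq> carrier A"
    using Op by auto
  have "map (term_val B w) ts = map h (map (term_val A v) ts)"
    using Op by simp
  then show ?case
    using assms(1,2) closed Op(1,2) by (simp add: hom_def is_algebra_def del: map_map)
qed

lemma pullback_in_Con:
  assumes "is_algebra L A" "h \<in> hom L A B" "\<theta> \<in> Con L B"
  shows "pullback A h \<theta> \<in> Con L A"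
proof (rule ConI)
  have h: "h x \<in> carrier B" if "x \<in> carrier A" for x
    using assms(2) that by (auto simp: hom_def)
  show "pullback A h \<theta> \<subseteq> Nabla A"
    by (auto simp: pullback_def)
  show "(x, x) \<in> pullback A h \<theta>" if "x \<in> carrier A" for x
    using that h Con_refl[OF assms(3)] by (auto simp: pullback_def)
  show "(y, x) \<in> pullback A h \<theta>" if "(x, y) \<in> pullback A h \<theta>" for x y
    using that Con_sym[OF assms(3)] by (auto simp: pullback_def)
  show "(x, z) \<in> pullback A h \<theta>"
    if "(x, y) \<in> pullback A h \<theta>" "(y, z) \<in> pullback A h \<theta>" for x y z
    using that Con_trans[OF assms(3)] by (auto simp: pullback_def)
  fix \<sigma> xs ys
  assume \<sigma>: "\<sigma> \<in> symbols L" and len: "length xs = arity L \<sigma>"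
    and rel: "list_all2 (\<lambda>x y. (x, y) \<in> pullback A h \<theta>) xs ys"
  have closed: "set xs \<subseteq> carrier A" "set ys \<subseteq> carrier A"
    using list_all2_subset_Nabla[OF rel] by (auto simp: pullback_def)
  have len': "length ys = arity L \<sigma>"
    using list_all2_lengthD[OF rel] len by simp
  have "list_all2 (\<lambda>x y. (x, y) \<in> \<theta>) (map h xs) (map h ys)"
    using rel by (auto simp: list_all2_map1 list_all2_map2 pullback_def elim: list_all2_mono)
  then have "(interp B \<sigma> (map h xs), interp B \<sigma> (map h ys)) \<in> \<theta>"
    using Con_interp[OF assms(3) \<sigma>] len by simp
  then show "(interp A \<sigma> xs, interp A \<sigma> ys) \<in> pullback A h \<theta>"
    using assms(1,2) \<sigma> len len' closed by (simp add: pullback_def hom_def is_algebra_def)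
qed

section \<open>Quotient algebras on representatives\<close>

text \<open>
  Quotients are realised on a set of representatives, so that they stay within the type \<open>'a\<close>
  over which the class ranges.
\<close>

definition repr :: "'a rel \<Rightarrow> 'a \<Rightarrow> 'a" where
  "repr \<delta> x = (SOME y. (x, y) \<in> \<delta>)"

definition quotient_algebra :: "('f, 'a) algebra \<Rightarrow> 'a rel \<Rightarrow> ('f, 'a) algebra" where
  "quotient_algebra M \<delta> =
     \<lparr>carrier = repr \<delta> ` carrier M, interp = (\<lambda>\<sigma> xs. repr \<delta> (interp M \<sigma> xs))\<rparr>"

context
  fixes L :: "'f signature" and M :: "('f, 'a) algebra" and \<delta> :: "'a rel"
  assumes alg: "is_algebra L M" and \<delta>: "\<delta> \<in> Con L M"
begin

lemma repr_rel: "x \<in> carrier M \<Longrightarrow> (x, repr \<delta> x) \<in> \<delta>"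
  unfolding repr_def using Con_refl[OF \<delta>] by (rule someI)

lemma repr_closed: "x \<in> carrier M \<Longrightarrow> repr \<delta> x \<in> carrier M"
  using repr_rel Con_subset[OF \<delta>] by blast

text \<open>Related elements have the same class, so the choice operator is applied to equal
  predicates and returns literally the same element.\<close>

lemma repr_eq: "(x, y) \<in> \<delta> \<Longrightarrow> repr \<delta> x = repr \<delta> y"
  unfolding repr_def using Con_sym[OF \<delta>] Con_trans[OF \<delta>] by (intro arg_cong[of _ _ Eps]) blast

lemma repr_eq_iff:
  assumes "x \<in> carrier M" "y \<in> carrier M"
  shows "repr \<delta> x = repr \<delta> y \<longleftrightarrow> (x, y) \<in> \<delta>"
  using repr_rel[OF assms(1)] repr_rel[OF assms(2)] Con_sym[OF \<delta>] Con_trans[OF \<delta>] repr_eq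
  by metis

lemma repr_idem: "x \<in> carrier M \<Longrightarrow> repr \<delta> (repr \<delta> x) = repr \<delta> x"
  using repr_eq[OF repr_rel] by simp

text \<open>Replacing every argument by its representative changes the result only within \<delta>,
  by compatibility, and \<open>repr\<close> removes that difference.\<close>

lemma repr_hom: "repr \<delta> \<in> hom L M (quotient_algebra M \<delta>)"
proof -
  have "repr \<delta> (interp M \<sigma> xs) = repr \<delta> (interp M \<sigma> (map (repr \<delta>) xs))"
    if "\<sigma> \<in> symbols L" "set xs \<subseteq> carrier M" "length xs = arity L \<sigma>" for \<sigma> xs
    using that repr_rel
    by (intro repr_eq Con_interp[OF \<delta>]) (auto simp: list_all2_map2 intro!: list_all2_refl list.rel_refl_strong)
  then show ?thesis
    by (auto simp: hom_def quotient_algebra_def)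
qed

lemma quotient_is_algebra: "is_algebra L (quotient_algebra M \<delta>)"
  unfolding is_algebra_def
proof (intro conjI ballI allI impI)
  show "carrier (quotient_algebra M \<delta>) \<noteq> {}"
    using alg by (simp add: quotient_algebra_def is_algebra_def)
  fix \<sigma> xs
  assume "\<sigma> \<in> symbols L"
    and xs: "set xs \<subseteq> carrier (quotient_algebra M \<delta>) \<and> length xs = arity L \<sigma>"
  moreover have "set xs \<subseteq> carrier M"
    using xs repr_closed by (auto simp: quotient_algebra_def)
  ultimately show "interp (quotient_algebra M \<delta>) \<sigma> xs \<in> carrier (quotient_algebra M \<delta>)"
    using interp_closed[OF alg] by (simp add: quotient_algebra_def)
qed

text \<open>A valuation in the quotient is also a valuation in \<open>M\<close> that
  \<open>repr\<close> fixes pointwise, so each term value in the quotient is the representative of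
  its value in \<open>M\<close>.\<close>

lemma quotient_satisfies:
  assumes "satisfies M e" "fst e \<in> terms L UNIV" "snd e \<in> terms L UNIV"
  shows "satisfies (quotient_algebra M \<delta>) e"
  unfolding satisfies_def
proof (intro allI impI)
  fix v :: "nat \<Rightarrow> 'a"
  assume "range v \<subseteq> carrier (quotient_algebra M \<delta>)"
  then have v: "v i \<in> repr \<delta> ` carrier M" for i
    by (auto simp: quotient_algebra_def)
  have vM: "v i \<in> carrier M" for i
    using v[of i] repr_closed by auto
  have vr: "v i = repr \<delta> (v i)" for i
    using v[of i] repr_idem by auto
  have "term_val (quotient_algebra M \<delta>) v t = repr \<delta> (term_val M v t)" if "t \<in> terms L UNIV" for t
    using term_val_hom[OF alg repr_hom that vM vr] by simp
  moreover have "term_val M v (fst e) = term_val M v (snd e)"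
    using assms(1) vM by (auto simp: satisfies_def)
  ultimately show "term_val (quotient_algebra M \<delta>) v (fst e) =
      term_val (quotient_algebra M \<delta>) v (snd e)"
    using assms(2,3) by simp
qed

lemma quotient_in_equational_class:
  assumes "equational_class L \<C>" "M \<in> \<C>"
  shows "quotient_algebra M \<delta> \<in> \<C>"
proof -
  obtain E where E: "E \<subseteq> terms L UNIV \<times> terms L UNIV"
    "\<C> = {M. is_algebra L M \<and> (\<forall>e\<in>E. satisfies M e)}"
    using assms(1) by (auto simp: equational_class_def)
  have "satisfies (quotient_algebra M \<delta>) e" if "e \<in> E" for e
    using that E assms(2) by (intro quotient_satisfies) auto
  then show ?thesis
    using E(2) quotient_is_algebra by simp
qed

text \<open>One direction of the correspondence theorem: on representatives, \<theta>/\<delta> is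
  just a restriction of \<theta>. The inclusion of \<delta> in \<theta> absorbs the
  \<open>repr\<close> that the quotient operations apply to their results.\<close>

lemma restrict_in_Con_quotient:
  assumes \<theta>: "\<theta> \<in> Con L M" and "\<delta> \<subseteq> \<theta>"
  shows "\<theta> \<inter> Nabla (quotient_algebra M \<delta>) \<in> Con L (quotient_algebra M \<delta>)"
proof (rule ConI)
  let ?Q = "quotient_algebra M \<delta>"
  have closed: "x \<in> carrier M" if "x \<in> carrier ?Q" for x
    using that repr_closed by (auto simp: quotient_algebra_def)
  show "(x, x) \<in> \<theta> \<inter> Nabla ?Q" if "x \<in> carrier ?Q" for x
    using that closed Con_refl[OF \<theta>] by auto
  show "(y, x) \<in> \<theta> \<inter> Nabla ?Q" if "(x, y) \<in> \<theta> \<inter> Nabla ?Q" for x y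
    using that Con_sym[OF \<theta>] by auto
  show "(x, z) \<in> \<theta> \<inter> Nabla ?Q"
    if "(x, y) \<in> \<theta> \<inter> Nabla ?Q" "(y, z) \<in> \<theta> \<inter> Nabla ?Q" for x y z
    using that Con_trans[OF \<theta>] by auto
  fix \<sigma> xs ys
  assume \<sigma>: "\<sigma> \<in> symbols L" and len: "length xs = arity L \<sigma>"
    and rel: "list_all2 (\<lambda>x y. (x, y) \<in> \<theta> \<inter> Nabla ?Q) xs ys"
  have "list_all2 (\<lambda>x y. (x, y) \<in> \<theta>) xs ys"
    using rel by (auto elim: list_all2_mono)
  then have *: "(interp M \<sigma> xs, interp M \<sigma> ys) \<in> \<theta>"
    by (rule Con_interp[OF \<theta> \<sigma> len])
  then have **: "interp M \<sigma> xs \<in> carrier M" "interp M \<sigma> ys \<in> carrier M"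
    using Con_subset[OF \<theta>] by auto
  have "(repr \<delta> (interp M \<sigma> xs), repr \<delta> (interp M \<sigma> ys)) \<in> \<theta>"
    using * repr_rel[OF **(1)] repr_rel[OF **(2)] \<open>\<delta> \<subseteq> \<theta>\<close>
    by (meson Con_sym[OF \<theta>] Con_trans[OF \<theta>] subsetD)
  then show "(interp ?Q \<sigma> xs, interp ?Q \<sigma> ys) \<in> \<theta> \<inter> Nabla ?Q"
    using ** by (simp add: quotient_algebra_def)
qed auto

text \<open>The restriction of \<theta> is one of the congruences intersected in \<open>Cg\<close>,
  and since \<open>repr\<close> moves elements only within \<theta>, pulling back does not leave
  \<theta>.\<close>

lemma pullback_Cg_quotient_least:
  assumes "s \<in> carrier M" "t \<in> carrier M" and \<theta>: "\<theta> \<in> Con L M" "\<delta> \<subseteq> \<theta>" "(s, t) \<in> \<theta>"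
  shows "pullback M (repr \<delta>) (Cg L (quotient_algebra M \<delta>) (repr \<delta> s) (repr \<delta> t)) \<subseteq> \<theta>"
proof (rule subrelI)
  let ?Q = "quotient_algebra M \<delta>"
  have rel: "(repr \<delta> x, repr \<delta> y) \<in> \<theta> \<longleftrightarrow> (x, y) \<in> \<theta>" if "x \<in> carrier M" "y \<in> carrier M" for x y
    using repr_rel[OF that(1)] repr_rel[OF that(2)] \<theta>(2)
    by (meson Con_sym[OF \<theta>(1)] Con_trans[OF \<theta>(1)] subsetD)
  have "(repr \<delta> s, repr \<delta> t) \<in> \<theta> \<inter> Nabla ?Q"
    using rel assms(1,2) \<theta>(3) by (simp add: quotient_algebra_def)
  then have "Cg L ?Q (repr \<delta> s) (repr \<delta> t) \<subseteq> \<theta>"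
    using restrict_in_Con_quotient[OF \<theta>(1,2)] unfolding Cg_def by blast
  moreover fix x y
  assume "(x, y) \<in> pullback M (repr \<delta>) (Cg L ?Q (repr \<delta> s) (repr \<delta> t))"
  ultimately show "(x, y) \<in> \<theta>"
    using rel by (auto simp: pullback_def)
qed

end

section \<open>EDPC and joins with principal congruences\<close>

lemma mem_Cg: "(a, b) \<in> Cg L M a b"
  by (simp add: Cg_def)

text \<open>One choice of EDPC terms is fixed, so that joins can be defined by an explicit formula
  in them.\<close>

locale edpc_class =
  fixes L :: "'f signature" and \<C> :: "('f, 'a) algebra set"
    and n :: nat and p q :: "nat \<Rightarrow> 'f trm"
  assumes equational: "equational_class L \<C>"
    and p_terms: "i \<in> {1..n} \<Longrightarrow> p i \<in> terms L {..<4}"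
    and q_terms: "i \<in> {1..n} \<Longrightarrow> q i \<in> terms L {..<4}"
    and Cg_eq: "M \<in> \<C> \<Longrightarrow> a \<in> carrier M \<Longrightarrow> b \<in> carrier M \<Longrightarrow>
      Cg L M a b = {(c, d) \<in> carrier M \<times> carrier M.
        \<forall>i\<in>{1..n}. term_val M ((!) [a, b, c, d]) (p i) = term_val M ((!) [a, b, c, d]) (q i)}"
begin

definition join_Cg :: "('f, 'a) algebra \<Rightarrow> 'a rel \<Rightarrow> 'a \<Rightarrow> 'a \<Rightarrow> 'a rel" where
  "join_Cg M \<delta> s t = {(c, d) \<in> carrier M \<times> carrier M.
     \<forall>i\<in>{1..n}. (term_val M ((!) [s, t, c, d]) (p i), term_val M ((!) [s, t, c, d]) (q i)) \<in> \<delta>}"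

text \<open>This is the distributive law for joins with a principal congruence; the formula merely
  asks for membership of certain pairs in the given relation.\<close>

lemma join_Cg_Int: "join_Cg M (\<delta>\<^sub>1 \<inter> \<delta>\<^sub>2) s t = join_Cg M \<delta>\<^sub>1 s t \<inter> join_Cg M \<delta>\<^sub>2 s t"
  by (auto simp: join_Cg_def)

lemma join_Cg_mono: "\<delta>\<^sub>1 \<subseteq> \<delta>\<^sub>2 \<Longrightarrow> join_Cg M \<delta>\<^sub>1 s t \<subseteq> join_Cg M \<delta>\<^sub>2 s t"
  by (auto simp: join_Cg_def)

lemma is_algebra: "M \<in> \<C> \<Longrightarrow> is_algebra L M"
  using equational by (auto simp: equational_class_def)

lemma term_val_hom4:
  assumes "is_algebra L A" "h \<in> hom L A B" "\<tau> \<in> terms L {..<4}"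
    and "{a, b, c, d} \<subseteq> carrier A"
  shows "term_val A ((!) [a, b, c, d]) \<tau> \<in> carrier A"
    and "term_val B ((!) [h a, h b, h c, h d]) \<tau> = h (term_val A ((!) [a, b, c, d]) \<tau>)"
proof -
  have "[a, b, c, d] ! i \<in> carrier A \<and> [h a, h b, h c, h d] ! i = h ([a, b, c, d] ! i)"
    if "i < 4" for i
  proof -
    have "i = 0 \<or> i = 1 \<or> i = 2 \<or> i = 3"
      using that by linarith
    then show ?thesis
      using assms(4) by auto
  qed
  then show "term_val A ((!) [a, b, c, d]) \<tau> \<in> carrier A"
    and "term_val B ((!) [h a, h b, h c, h d]) \<tau> = h (term_val A ((!) [a, b, c, d]) \<tau>)"
    using term_val_hom[OF assms(1-3), of "(!) [a, b, c, d]" "(!) [h a, h b, h c, h d]"] by auto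
qed

text \<open>Homomorphisms commute with terms, so the pairs tested in \<open>B\<close> are the images
  of those tested in \<open>A\<close>.\<close>

lemma pullback_join_Cg:
  assumes "A \<in> \<C>" "h \<in> hom L A B" "s \<in> carrier A" "t \<in> carrier A"
  shows "pullback A h (join_Cg B \<delta> (h s) (h t)) = join_Cg A (pullback A h \<delta>) s t"
proof -
  have "h x \<in> carrier B" if "x \<in> carrier A" for x
    using assms(2) that by (auto simp: hom_def)
  then show ?thesis
    using term_val_hom4[OF is_algebra[OF assms(1)] assms(2) p_terms]
      term_val_hom4[OF is_algebra[OF assms(1)] assms(2) q_terms] assms(3,4)
    by (auto simp: pullback_def join_Cg_def)
qed

text \<open>EDPC is applied to the quotient, which stays in the equational class. There equality is
  \<open>Delta\<close>, whose pullback along \<open>repr\<close> is \<delta>, so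
  \<open>pullback_join_Cg\<close> transfers the formula to \<open>M\<close>.\<close>

lemma join_Cg_eq_pullback:
  assumes "M \<in> \<C>" "\<delta> \<in> Con L M" "s \<in> carrier M" "t \<in> carrier M"
  shows "join_Cg M \<delta> s t =
    pullback M (repr \<delta>) (Cg L (quotient_algebra M \<delta>) (repr \<delta> s) (repr \<delta> t))"
proof -
  let ?Q = "quotient_algebra M \<delta>"
  have alg: "is_algebra L M"
    using assms(1) by (rule is_algebra)
  have r: "repr \<delta> x \<in> carrier ?Q" if "x \<in> carrier M" for x
    using that by (simp add: quotient_algebra_def)
  have Q: "?Q \<in> \<C>"
    using quotient_in_equational_class[OF alg assms(2) equational assms(1)] .
  have "pullback M (repr \<delta>) (Delta ?Q) = \<delta>"
    using r repr_eq_iff[OF alg assms(2)] Con_subset[OF assms(2)]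
    by (auto simp: pullback_def Id_on_iff)
  moreover have "Cg L ?Q (repr \<delta> s) (repr \<delta> t) = join_Cg ?Q (Delta ?Q) (repr \<delta> s) (repr \<delta> t)"
  proof -
    \<comment> \<open>\<open>Cg_eq\<close> speaks of plain equality, whereas \<open>Delta\<close>
      relates only elements of the carrier; the term values must therefore be shown to lie in
      it.\<close>
    have "term_val ?Q ((!) [repr \<delta> s, repr \<delta> t, c, d]) \<tau> \<in> carrier ?Q"
      if "c \<in> carrier ?Q" "d \<in> carrier ?Q" "\<tau> \<in> terms L {..<4}" for c d \<tau>
    proof -
      \<comment> \<open>The identity serves only to extract closure of the carrier under terms from
        \<open>term_val_hom4\<close>.\<close>
      have "id \<in> hom L ?Q ?Q"
        by (simp add: hom_def)
      from term_val_hom4(1)[OF is_algebra[OF Q] this that(3)] show ?thesis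
        using that r assms(3,4) by simp
    qed
    then show ?thesis
      using p_terms q_terms
      by (auto simp: Cg_eq[OF Q r[OF assms(3)] r[OF assms(4)]] join_Cg_def Id_on_iff)
  qed
  ultimately show ?thesis
    using pullback_join_Cg[OF assms(1) repr_hom[OF alg assms(2)] assms(3,4)] by simp
qed

context
  fixes M \<delta> s t
  assumes M: "M \<in> \<C>" and \<delta>: "\<delta> \<in> Con L M" and s: "s \<in> carrier M" and t: "t \<in> carrier M"
begin

lemma quotient_Cg_in_Con:
  "Cg L (quotient_algebra M \<delta>) (repr \<delta> s) (repr \<delta> t) \<in> Con L (quotient_algebra M \<delta>)"
  using quotient_is_algebra[OF is_algebra[OF M] \<delta>] s t
  by (intro Cg_in_Con) (simp_all add: quotient_algebra_def)

lemma join_Cg_in_Con: "join_Cg M \<delta> s t \<in> Con L M"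
  unfolding join_Cg_eq_pullback[OF M \<delta> s t]
  by (intro pullback_in_Con[OF is_algebra[OF M] repr_hom[OF is_algebra[OF M] \<delta>]] quotient_Cg_in_Con)

text \<open>Pairs in \<delta> are collapsed by \<open>repr\<close>, and the principal congruence of
  the quotient is reflexive.\<close>

lemma subset_join_Cg: "\<delta> \<subseteq> join_Cg M \<delta> s t"
  unfolding join_Cg_eq_pullback[OF M \<delta> s t]
proof (rule subrelI)
  fix x y assume xy: "(x, y) \<in> \<delta>"
  then have *: "x \<in> carrier M" "y \<in> carrier M"
    using Con_subset[OF \<delta>] by auto
  have "repr \<delta> x = repr \<delta> y"
    using repr_eq[OF is_algebra[OF M] \<delta> xy] .
  moreover have "repr \<delta> x \<in> carrier (quotient_algebra M \<delta>)"
    using * by (simp add: quotient_algebra_def)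
  ultimately show
    "(x, y) \<in> pullback M (repr \<delta>) (Cg L (quotient_algebra M \<delta>) (repr \<delta> s) (repr \<delta> t))"
    using * Con_refl[OF quotient_Cg_in_Con] by (simp add: pullback_def)
qed

lemma mem_join_Cg: "(s, t) \<in> join_Cg M \<delta> s t"
  unfolding join_Cg_eq_pullback[OF M \<delta> s t] using s t by (simp add: pullback_def mem_Cg)

lemma join_Cg_least: "\<theta> \<in> Con L M \<Longrightarrow> \<delta> \<subseteq> \<theta> \<Longrightarrow> (s, t) \<in> \<theta> \<Longrightarrow> join_Cg M \<delta> s t \<subseteq> \<theta>"
  unfolding join_Cg_eq_pullback[OF M \<delta> s t]
  by (rule pullback_Cg_quotient_least[OF is_algebra[OF M] \<delta> s t])

end

lemma join_Cg_absorb: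
  assumes "M \<in> \<C>" "\<theta> \<in> Con L M" "(s, t) \<in> \<theta>"
  shows "join_Cg M \<theta> s t = \<theta>"
proof -
  have "s \<in> carrier M" "t \<in> carrier M"
    using assms(2,3) Con_subset by blast+
  then show ?thesis
    using join_Cg_least[of M \<theta> s t \<theta>] subset_join_Cg[of M \<theta> s t] assms by auto
qed

section \<open>Enlarging congruences and lifting primes\<close>

text \<open>Take \<delta> maximal above \<alpha> with \<delta> \<inter> \<beta> inside \<theta>.
  Joining \<delta> with \<open>Cg L M s t\<close> for a pair of \<theta> preserves this condition:
  by distributivity the new intersection lies in the join of \<theta> with that principal
  congruence, which is \<theta> itself. Maximality then puts the pair into \<delta>.\<close>

lemma extend_above:
  assumes M: "M \<in> \<C>" and Con: "\<alpha> \<in> Con L M" "\<beta> \<in> Con L M" "\<theta> \<in> Con L M"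
    and "\<alpha> \<inter> \<beta> \<subseteq> \<theta>"
  obtains \<delta> where "\<delta> \<in> Con L M" "\<alpha> \<subseteq> \<delta>" "\<theta> \<subseteq> \<delta>" "\<delta> \<inter> \<beta> \<subseteq> \<theta>"
proof -
  \<comment> \<open>Avoiding \<open>\<beta> - \<theta>\<close> encodes the condition that the
    intersection with \<beta> lies in \<theta>.\<close>
  have "\<alpha> \<inter> (\<beta> - \<theta>) = {}"
    using assms(5) by auto
  then obtain \<delta> where \<delta>: "\<delta> \<in> Con L M" "\<alpha> \<subseteq> \<delta>" "\<delta> \<inter> (\<beta> - \<theta>) = {}"
    and max: "\<And>\<epsilon>. \<epsilon> \<in> Con L M \<Longrightarrow> \<delta> \<subseteq> \<epsilon> \<Longrightarrow> \<epsilon> \<inter> (\<beta> - \<theta>) = {} \<Longrightarrow> \<epsilon> = \<delta>"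
    using maximal_congruence_avoiding[OF Con(1)] by metis
  have \<delta>\<beta>: "\<delta> \<inter> \<beta> \<subseteq> \<theta>"
    using \<delta>(3) by auto
  have "\<theta> \<subseteq> \<delta>"
  proof (rule subrelI)
    fix s t assume st: "(s, t) \<in> \<theta>"
    then have carr: "s \<in> carrier M" "t \<in> carrier M"
      using Con_subset[OF Con(3)] by auto
    have "join_Cg M \<delta> s t \<inter> \<beta> \<subseteq> join_Cg M \<delta> s t \<inter> join_Cg M \<beta> s t"
      using subset_join_Cg[OF M Con(2) carr] by auto
    also have "\<dots> = join_Cg M (\<delta> \<inter> \<beta>) s t"
      by (simp add: join_Cg_Int)
    also have "\<dots> \<subseteq> join_Cg M \<theta> s t"
      using \<delta>\<beta> by (rule join_Cg_mono)
    also have "\<dots> = \<theta>"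
      using M Con(3) st by (rule join_Cg_absorb)
    finally have "join_Cg M \<delta> s t \<inter> (\<beta> - \<theta>) = {}"
      by auto
    then have "join_Cg M \<delta> s t = \<delta>"
      by (rule max[OF join_Cg_in_Con[OF M \<delta>(1) carr] subset_join_Cg[OF M \<delta>(1) carr]])
    then show "(s, t) \<in> \<delta>"
      using mem_join_Cg[OF M \<delta>(1) carr] by simp
  qed
  then show thesis
    using that \<delta>(1,2) \<delta>\<beta> by blast
qed

lemma lying_over:
  assumes A: "A \<in> \<C>" and B: "B \<in> \<C>" and f: "f \<in> hom L A B"
    and \<phi>: "\<phi> \<in> Spec L A" and ker: "Ker A B f \<subseteq> \<phi>"
  shows "\<exists>\<theta>\<in>Spec L B. pullback A f \<theta> = \<phi>"
proof -
  \<comment> \<open>\<open>N\<close> collects the images of the pairs outside \<phi>; avoiding it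
    means having a pullback below \<phi>, which is the form required for Zorn's lemma.\<close>
  define N where "N = map_prod f f ` (Nabla A - \<phi>)"
  have avoid: "\<theta> \<inter> N = {} \<longleftrightarrow> pullback A f \<theta> \<subseteq> \<phi>" for \<theta>
    unfolding N_def pullback_def by auto
  have \<phi>Con: "\<phi> \<in> Con L A"
    using \<phi> by (simp add: Spec_def)
  have algA: "is_algebra L A"
    using A by (rule is_algebra)
  \<comment> \<open>The kernel hypothesis makes \<open>Delta B\<close> a starting point for the
    maximal choice.\<close>
  have "Delta B \<inter> N = {}"
    using ker by (simp add: avoid Ker_def)
  from maximal_congruence_avoiding[OF Delta_in_Con[OF is_algebra[OF B]] this]
  obtain \<theta> where \<theta>: "\<theta> \<in> Con L B" "pullback A f \<theta> \<subseteq> \<phi>"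
    and max: "\<And>\<epsilon>. \<epsilon> \<in> Con L B \<Longrightarrow> \<theta> \<subseteq> \<epsilon> \<Longrightarrow> pullback A f \<epsilon> \<subseteq> \<phi> \<Longrightarrow> \<epsilon> = \<theta>"
    unfolding avoid by metis
  have "\<phi> \<subseteq> pullback A f \<theta>"
  proof (rule subrelI)
    fix a b assume ab: "(a, b) \<in> \<phi>"
    then have carr: "a \<in> carrier A" "b \<in> carrier A"
      using Con_subset[OF \<phi>Con] by auto
    then have fcarr: "f a \<in> carrier B" "f b \<in> carrier B"
      using f by (auto simp: hom_def)
    have "pullback A f (join_Cg B \<theta> (f a) (f b)) = join_Cg A (pullback A f \<theta>) a b"
      using A f carr by (rule pullback_join_Cg)
    also have "\<dots> \<subseteq> join_Cg A \<phi> a b"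
      using \<theta>(2) by (rule join_Cg_mono)
    also have "\<dots> = \<phi>"
      using A \<phi>Con ab by (rule join_Cg_absorb)
    finally have "join_Cg B \<theta> (f a) (f b) = \<theta>"
      by (rule max[OF join_Cg_in_Con[OF B \<theta>(1) fcarr] subset_join_Cg[OF B \<theta>(1) fcarr]])
    then show "(a, b) \<in> pullback A f \<theta>"
      using mem_join_Cg[OF B \<theta>(1) fcarr] carr by (simp add: pullback_def)
  qed
  with \<theta>(2) have eq: "pullback A f \<theta> = \<phi>"
    by auto
  have "\<theta> \<noteq> Nabla B"
  proof
    assume "\<theta> = Nabla B"
    then have "pullback A f \<theta> = Nabla A"
      using f by (auto simp: pullback_def hom_def)
    then show False
      using eq \<phi> by (simp add: Spec_def)
  qed
  moreover have "\<alpha> \<subseteq> \<theta> \<or> \<beta> \<subseteq> \<theta>"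
    if Con: "\<alpha> \<in> Con L B" "\<beta> \<in> Con L B" and sub: "\<alpha> \<inter> \<beta> \<subseteq> \<theta>" for \<alpha> \<beta>
  proof -
    obtain \<alpha>' where \<alpha>': "\<alpha>' \<in> Con L B" "\<alpha> \<subseteq> \<alpha>'" "\<theta> \<subseteq> \<alpha>'" "\<alpha>' \<inter> \<beta> \<subseteq> \<theta>"
      by (rule extend_above[OF B Con \<theta>(1) sub])
    \<comment> \<open>The second enlargement is carried out against \<open>\<alpha>'\<close> rather
      than \<alpha>, so that both enlarged congruences lie above \<theta> while their intersection
      is still inside \<theta>.\<close>
    have "\<beta> \<inter> \<alpha>' \<subseteq> \<theta>"
      using \<alpha>'(4) by auto
    then obtain \<beta>' where \<beta>': "\<beta>' \<in> Con L B" "\<beta> \<subseteq> \<beta>'" "\<theta> \<subseteq> \<beta>'" "\<beta>' \<inter> \<alpha>' \<subseteq> \<theta>"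
      by (rule extend_above[OF B Con(2) \<alpha>'(1) \<theta>(1)])
    have "pullback A f \<alpha>' \<inter> pullback A f \<beta>' \<subseteq> pullback A f \<theta>"
      using \<beta>'(4) by (auto simp: pullback_def)
    then have "pullback A f \<alpha>' \<subseteq> \<phi> \<or> pullback A f \<beta>' \<subseteq> \<phi>"
      using \<phi> eq pullback_in_Con[OF algA f \<alpha>'(1)] pullback_in_Con[OF algA f \<beta>'(1)]
      by (auto simp: Spec_def)
    \<comment> \<open>Primeness has put one of the two pullbacks below \<phi>; as both congruences
      contain \<theta>, maximality identifies that one with \<theta>.\<close>
    then have "\<alpha>' = \<theta> \<or> \<beta>' = \<theta>"
      using max \<alpha>'(1,3) \<beta>'(1,3) by blast
    then show ?thesis
      using \<alpha>'(2) \<beta>'(2) by auto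
  qed
  ultimately have "\<theta> \<in> Spec L B"
    using \<theta>(1) by (simp add: Spec_def)
  then show ?thesis
    using eq by blast
qed

end

theorem corollary8p14:
  fixes L :: "'f signature" and \<C> :: "('f, 'a) algebra set"
  assumes "equational_class L \<C>"
    and "semi_degenerate L \<C>"
    and "has_EDPC L \<C>"
  shows "\<forall>A\<in>\<C>. \<forall>B\<in>\<C>. \<forall>f\<in>hom L A B. admissible L A B f \<longrightarrow> fulfills_LO L A B f"
proof -
  from assms(3) obtain n :: nat and p q :: "nat \<Rightarrow> 'f trm" where
    "\<forall>i\<in>{1..n}. p i \<in> terms L {..<4} \<and> q i \<in> terms L {..<4}"
    "\<forall>M\<in>\<C>. \<forall>a\<in>carrier M. \<forall>b\<in>carrier M.
       Cg L M a b = {(c, d) \<in> carrier M \<times> carrier M.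
         \<forall>i\<in>{1..n}. term_val M ((!) [a, b, c, d]) (p i) = term_val M ((!) [a, b, c, d]) (q i)}"
    unfolding has_EDPC_def by blast
  then interpret edpc_class L \<C> n p q
    using assms(1) by unfold_locales blast+
  show ?thesis
    using lying_over by (simp add: fulfills_LO_def)
qed

end
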